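(* If a random variable $X$ has a moment-generating function (i.e. $\mathbb{E}[e^{sX}]<\infty$ for all $s$ in some open interval around $0$), then $$\lim_{n\to\infty}\sup_{t\ge0}\big(\mathrm{pmmse}_n(X,t)-\mathrm{mmse}(X,t)\big)=0.$$
   Context: $N\sim\mathcal{N}(0,1)$ independent of $X$, $Y_t=\sqrt{t}X+N$. $\mathrm{pmmse}_n(X,t):=\min_{\boldsymbol{c}\in\mathbb{R}^{n+1}}\mathbb{E}[(X-\boldsymbol{c}^T(1,Y_t,\dots,Y_t^n)^T)^2]$ and $\mathrm{mmse}(X,t):=\mathbb{E}[(X-\mathbb{E}[X\mid Y_t])^2]$. *)

theory Defs
  imports "HOL-Probability.Probability"
begin

definition obs :: "('a \<Rightarrow> real) \<Rightarrow> ('a \<Rightarrow> real) \<Rightarrow> real \<Rightarrow> 'a \<Rightarrow> real" where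
  "obs X N t = (\<lambda>\<omega>. sqrt t * X \<omega> + N \<omega>)"

text \<open>pmmse_n(X,t): minimal mean squared error over polynomial estimators of degree at most n
  in Y_t (coefficient vector c_0..c_n; the minimum is written as an infimum).\<close>
definition pmmse :: "'a measure \<Rightarrow> ('a \<Rightarrow> real) \<Rightarrow> ('a \<Rightarrow> real) \<Rightarrow> nat \<Rightarrow> real \<Rightarrow> real" where
  "pmmse M X N n t = (INF c \<in> (UNIV :: (nat \<Rightarrow> real) set).
      integral\<^sup>L M (\<lambda>\<omega>. (X \<omega> - (\<Sum>i\<le>n. c i * obs X N t \<omega> ^ i))\<^sup>2))"

definition mmse :: "'a measure \<Rightarrow> ('a \<Rightarrow> real) \<Rightarrow> ('a \<Rightarrow> real) \<Rightarrow> real \<Rightarrow> real" where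
  "mmse M X N t = integral\<^sup>L M (\<lambda>\<omega>.
      (X \<omega> - real_cond_exp M (vimage_algebra (space M) (obs X N t) borel) X \<omega>)\<^sup>2)"

end

theory Submission
  imports Defs "HOL-Real_Asymp.Real_Asymp"
begin

text \<open>
  Write \<open>Y\<^sub>t = sqrt t * X + N\<close> and \<open>g\<^sub>t(Y\<^sub>t) = E[X | Y\<^sub>t]\<close>. The gap \<open>pmmse\<^sub>n - mmse\<close> is decreasing
  in \<open>n\<close>, and a Dini argument on \<open>[0, \<infinity>]\<close> makes its pointwise convergence uniform.
  At infinity the linear estimator \<open>Y\<^sub>t / sqrt t\<close> bounds it by \<open>E[N\<^sup>2] / t\<close>. Pointwise convergence
  is density of polynomials in \<open>L\<^sup>2\<close> of the law of \<open>Y\<^sub>t\<close>, which has exponential moments. The gap is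
  upper semicontinuous in \<open>t\<close>: the error of a fixed polynomial is continuous by dominated convergence, and \<open>mmse\<close> is lower
  semicontinuous by Fatou's lemma, because \<open>g\<^sub>t(y)\<close> is a ratio of Gaussian averages, jointly
  continuous in \<open>(t, y)\<close>.
\<close>

section \<open>Density of polynomials under exponential moments\<close>

lemma integrable_square_diff:
  fixes f g :: "'a \<Rightarrow> real"
  assumes [measurable]: "f \<in> borel_measurable M" "g \<in> borel_measurable M"
    and "integrable M (\<lambda>\<omega>. (f \<omega>)\<^sup>2)" "integrable M (\<lambda>\<omega>. (g \<omega>)\<^sup>2)"
  shows "integrable M (\<lambda>\<omega>. (f \<omega> - g \<omega>)\<^sup>2)"
proof (rule Bochner_Integration.integrable_bound)
  show "integrable M (\<lambda>\<omega>. 2 * (f \<omega>)\<^sup>2 + 2 * (g \<omega>)\<^sup>2)"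
    using assms by auto
  have "(f \<omega> - g \<omega>)\<^sup>2 \<le> 2 * (f \<omega>)\<^sup>2 + 2 * (g \<omega>)\<^sup>2" for \<omega>
    using zero_le_power2[of "f \<omega> + g \<omega>"] by (simp add: power2_eq_square algebra_simps)
  then show "AE \<omega> in M. norm ((f \<omega> - g \<omega>)\<^sup>2) \<le> norm (2 * (f \<omega>)\<^sup>2 + 2 * (g \<omega>)\<^sup>2)"
    by (intro AE_I2) (auto intro: order_trans)
qed measurable

lemma integral_square_diff_triangle:
  fixes f g h :: "'a \<Rightarrow> real"
  assumes [measurable]: "f \<in> borel_measurable M" "g \<in> borel_measurable M" "h \<in> borel_measurable M"
    and f2: "integrable M (\<lambda>\<omega>. (f \<omega>)\<^sup>2)" and g2: "integrable M (\<lambda>\<omega>. (g \<omega>)\<^sup>2)"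
    and h2: "integrable M (\<lambda>\<omega>. (h \<omega>)\<^sup>2)"
  shows "(\<integral>\<omega>. (f \<omega> - h \<omega>)\<^sup>2 \<partial>M) \<le> 2 * (\<integral>\<omega>. (f \<omega> - g \<omega>)\<^sup>2 \<partial>M) + 2 * (\<integral>\<omega>. (g \<omega> - h \<omega>)\<^sup>2 \<partial>M)"
proof -
  have *: "integrable M (\<lambda>\<omega>. (f \<omega> - g \<omega>)\<^sup>2)" "integrable M (\<lambda>\<omega>. (g \<omega> - h \<omega>)\<^sup>2)"
    "integrable M (\<lambda>\<omega>. (f \<omega> - h \<omega>)\<^sup>2)"
    using f2 g2 h2 by (auto intro!: integrable_square_diff)
  have "(f \<omega> - h \<omega>)\<^sup>2 \<le> 2 * (f \<omega> - g \<omega>)\<^sup>2 + 2 * (g \<omega> - h \<omega>)\<^sup>2" for \<omega>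
    using zero_le_power2[of "(f \<omega> - g \<omega>) - (g \<omega> - h \<omega>)"]
    by (simp add: power2_eq_square algebra_simps)
  then have "(\<integral>\<omega>. (f \<omega> - h \<omega>)\<^sup>2 \<partial>M) \<le> (\<integral>\<omega>. 2 * (f \<omega> - g \<omega>)\<^sup>2 + 2 * (g \<omega> - h \<omega>)\<^sup>2 \<partial>M)"
    using * by (intro integral_mono) auto
  also have "\<dots> = 2 * (\<integral>\<omega>. (f \<omega> - g \<omega>)\<^sup>2 \<partial>M) + 2 * (\<integral>\<omega>. (g \<omega> - h \<omega>)\<^sup>2 \<partial>M)"
    using * by simp
  finally show ?thesis .
qed

lemma borel_measurable_poly [measurable (raw)]:
  fixes f :: "'a \<Rightarrow> real"
  assumes "f \<in> borel_measurable M"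
  shows "(\<lambda>x. poly p (f x)) \<in> borel_measurable M"
  using assms by (rule measurable_compose)
    (intro borel_measurable_continuous_onI continuous_intros)

text \<open>Induction on the coefficients: each extra factor \<open>y\<close> uses up half of the
  exponent, since \<bar>y\<bar> is itself at most a multiple of
  \<open>exp (c/2 * \<bar>y\<bar>)\<close>. Hence the induction hypothesis is needed for every
  \<open>c\<close>.\<close>

lemma abs_poly_le_exp:
  fixes p :: "real poly"
  assumes "0 < c"
  shows "\<exists>K\<ge>0. \<forall>y. \<bar>poly p y\<bar> \<le> K * exp (c * \<bar>y\<bar>)"
  using assms
proof (induction p arbitrary: c)
  case 0
  then show ?case by (auto intro: exI[of _ 0])
next
  case (pCons a p)
  from pCons.IH[of "c/2"] pCons.prems obtain K
    where K: "K \<ge> 0" "\<And>y. \<bar>poly p y\<bar> \<le> K * exp (c/2 * \<bar>y\<bar>)" by auto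
  have lin: "\<bar>y\<bar> \<le> 2/c * exp (c/2 * \<bar>y\<bar>)" for y
    using exp_ge_add_one_self[of "c/2 * \<bar>y\<bar>"] \<open>c > 0\<close> by (simp add: field_simps)
  have "\<bar>poly (pCons a p) y\<bar> \<le> (\<bar>a\<bar> + 2/c * K) * exp (c * \<bar>y\<bar>)" for y
  proof -
    have "\<bar>poly (pCons a p) y\<bar> \<le> \<bar>a\<bar> * 1 + \<bar>y\<bar> * \<bar>poly p y\<bar>"
      using abs_triangle_ineq[of a "y * poly p y"] by (simp add: abs_mult)
    also have "\<dots> \<le> \<bar>a\<bar> * exp (c * \<bar>y\<bar>) + (2/c * exp (c/2 * \<bar>y\<bar>)) * (K * exp (c/2 * \<bar>y\<bar>))"
      using \<open>c > 0\<close> K by (intro add_mono mult_mono lin K) auto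
    also have "\<dots> = (\<bar>a\<bar> + 2/c * K) * exp (c * \<bar>y\<bar>)"
      by (simp add: algebra_simps flip: exp_add)
    finally show ?thesis .
  qed
  then show ?case
    using K(1) \<open>c > 0\<close> by (intro exI[of _ "\<bar>a\<bar> + 2/c * K"]) auto
qed

text \<open>The square is the value of the polynomial \<open>p * p\<close>, so the exponential bound
  applies to it with the full exponent \<open>c\<close>.\<close>

lemma integrable_poly_sq:
  assumes [measurable]: "Y \<in> borel_measurable M"
    and "0 < c" and int: "integrable M (\<lambda>\<omega>. exp (c * \<bar>Y \<omega>\<bar>))"
  shows "integrable M (\<lambda>\<omega>. (poly p (Y \<omega>) :: real)\<^sup>2)"
proof -
  obtain K where K: "\<And>y. \<bar>poly (p * p) y\<bar> \<le> K * exp (c * \<bar>y\<bar>)"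
    using abs_poly_le_exp[OF \<open>0 < c\<close>] by blast
  show ?thesis
    unfolding power2_eq_square poly_mult[symmetric]
    by (rule Bochner_Integration.integrable_bound[of _ "\<lambda>\<omega>. K * exp (c * \<bar>Y \<omega>\<bar>)"])
       (use int in \<open>auto intro!: AE_I2 order_trans[OF K] simp del: poly_mult\<close>)
qed

text \<open>The frequency \<xi> is absorbed into the coefficients, so that the partial sum is a
  polynomial in the variable itself and can be multiplied by other polynomials.\<close>

definition sin_taylor :: "real \<Rightarrow> nat \<Rightarrow> real poly" where
  "sin_taylor \<xi> n = (\<Sum>k<n. monom (sin_coeff k * \<xi> ^ k) k)"

lemma poly_sin_taylor: "poly (sin_taylor \<xi> n) y = (\<Sum>k<n. sin_coeff k * (\<xi> * y) ^ k)"
  by (simp add: sin_taylor_def poly_sum poly_monom power_mult_distrib mult.assoc)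

lemma sin_taylor_tendsto: "(\<lambda>n. poly (sin_taylor \<xi> n) y) \<longlonglongrightarrow> sin (\<xi> * y)"
  using sin_converges[of "\<xi> * y"] by (simp add: poly_sin_taylor sums_def)

text \<open>Taking absolute values turns the sine series into part of the exponential series. The
  bound is uniform in \<open>n\<close>, as dominated convergence requires.\<close>

lemma abs_sin_taylor_le: "\<bar>poly (sin_taylor \<xi> n) y\<bar> \<le> exp (\<bar>\<xi>\<bar> * \<bar>y\<bar>)"
proof -
  have "\<bar>poly (sin_taylor \<xi> n) y\<bar> \<le> (\<Sum>k<n. \<bar>sin_coeff k * (\<xi> * y) ^ k\<bar>)"
    unfolding poly_sin_taylor by (rule sum_abs)
  also have "\<dots> \<le> (\<Sum>k<n. (\<bar>\<xi>\<bar> * \<bar>y\<bar>) ^ k /\<^sub>R fact k)"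
    by (intro sum_mono) (auto simp: sin_coeff_def abs_mult power_abs power_mult_distrib divide_simps)
  also have "\<dots> \<le> exp (\<bar>\<xi>\<bar> * \<bar>y\<bar>)"
    using exp_converges[of "\<bar>\<xi>\<bar> * \<bar>y\<bar>"]
    by (intro sum_le_suminf[THEN order_trans]) (auto simp: sums_iff)
  finally show ?thesis .
qed

section \<open>The L2 closure of the polynomials in one random variable\<close>

text \<open>Square integrability is part of the definition because the Bochner integral of a
  non-integrable function is 0, which would make the approximation condition meaningless.\<close>

definition poly_closure :: "'a measure \<Rightarrow> ('a \<Rightarrow> real) \<Rightarrow> ('a \<Rightarrow> real) set" where
  "poly_closure M Y = {f \<in> borel_measurable M. integrable M (\<lambda>\<omega>. (f \<omega>)\<^sup>2) \<and>
     (\<forall>e>0. \<exists>p. (\<integral>\<omega>. (f \<omega> - poly p (Y \<omega>))\<^sup>2 \<partial>M) < e)}"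

locale exp_moment = prob_space M for M :: "'a measure" +
  fixes Y :: "'a \<Rightarrow> real" and c :: real
  assumes Y [measurable]: "Y \<in> borel_measurable M"
    and c_pos: "0 < c"
    and exp_int: "integrable M (\<lambda>\<omega>. exp (c * \<bar>Y \<omega>\<bar>))"
begin

lemma poly_Y [measurable]: "(\<lambda>\<omega>. poly p (Y \<omega>)) \<in> borel_measurable M"
  by (intro borel_measurable_poly Y)

lemmas poly_sq = integrable_poly_sq[OF Y c_pos exp_int]

lemma poly_closureD:
  assumes "f \<in> poly_closure M Y"
  shows "f \<in> borel_measurable M" "integrable M (\<lambda>\<omega>. (f \<omega>)\<^sup>2)"
    "\<And>e. e > 0 \<Longrightarrow> \<exists>p. (\<integral>\<omega>. (f \<omega> - poly p (Y \<omega>))\<^sup>2 \<partial>M) < e"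
  using assms by (auto simp: poly_closure_def)

lemma poly_closure_closed:
  assumes f [measurable]: "f \<in> borel_measurable M" and f2: "integrable M (\<lambda>\<omega>. (f \<omega>)\<^sup>2)"
    and ex: "\<And>e. e > 0 \<Longrightarrow> \<exists>g\<in>poly_closure M Y. (\<integral>\<omega>. (f \<omega> - g \<omega>)\<^sup>2 \<partial>M) < e"
  shows "f \<in> poly_closure M Y"
proof -
  have "\<exists>p. (\<integral>\<omega>. (f \<omega> - poly p (Y \<omega>))\<^sup>2 \<partial>M) < e" if "e > 0" for e
  proof -
    \<comment> \<open>Two errors of \<open>e/4\<close> suffice: the triangle inequality for squared
      distances doubles each of them.\<close>
    obtain g where g: "g \<in> poly_closure M Y" "(\<integral>\<omega>. (f \<omega> - g \<omega>)\<^sup>2 \<partial>M) < e/4"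
      using ex[of "e/4"] \<open>e > 0\<close> by auto
    obtain p where p: "(\<integral>\<omega>. (g \<omega> - poly p (Y \<omega>))\<^sup>2 \<partial>M) < e/4"
      using poly_closureD(3)[OF g(1), of "e/4"] \<open>e > 0\<close> by auto
    have "(\<integral>\<omega>. (f \<omega> - poly p (Y \<omega>))\<^sup>2 \<partial>M) < e"
      using integral_square_diff_triangle[OF f poly_closureD(1)[OF g(1)] poly_Y f2 poly_closureD(2)[OF g(1)] poly_sq, of p] g(2) p
      by linarith
    then show ?thesis ..
  qed
  then show ?thesis using f f2 by (auto simp: poly_closure_def)
qed

lemma poly_closure_poly: "(\<lambda>\<omega>. poly p (Y \<omega>)) \<in> poly_closure M Y"
  by (auto simp: poly_closure_def poly_sq intro!: exI[of _ p])

text \<open>Dominated convergence turns pointwise convergence into L2 convergence. Square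
  integrability of the limit comes out as well, because \<open>f\<close> differs from
  \<open>g 0\<close> by a square integrable function.\<close>

lemma poly_closure_limit:
  assumes [measurable]: "f \<in> borel_measurable M" and g: "\<And>n. g n \<in> poly_closure M Y"
    and lim: "\<And>\<omega>. (\<lambda>n. g n \<omega>) \<longlonglongrightarrow> f \<omega>"
    and w: "integrable M w" "\<And>n \<omega>. (f \<omega> - g n \<omega>)\<^sup>2 \<le> w \<omega>"
  shows "f \<in> poly_closure M Y"
proof -
  note [measurable] = poly_closureD(1)[OF g]
  have "(\<lambda>n. \<integral>\<omega>. (f \<omega> - g n \<omega>)\<^sup>2 \<partial>M) \<longlonglongrightarrow> (\<integral>\<omega>. 0 \<partial>M)"
  proof (rule integral_dominated_convergence[where w = w])
    show "AE \<omega> in M. (\<lambda>n. (f \<omega> - g n \<omega>)\<^sup>2) \<longlonglongrightarrow> 0"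
      using lim by (intro AE_I2) (auto intro!: tendsto_eq_intros)
  qed (use w in auto)
  then have tends: "(\<lambda>n. \<integral>\<omega>. (f \<omega> - g n \<omega>)\<^sup>2 \<partial>M) \<longlonglongrightarrow> 0" by simp
  have d: "integrable M (\<lambda>\<omega>. (f \<omega> - g 0 \<omega>)\<^sup>2)"
    by (rule Bochner_Integration.integrable_bound[OF w(1)])
       (auto intro!: AE_I2 order_trans[OF w(2)])
  have "integrable M (\<lambda>\<omega>. ((f \<omega> - g 0 \<omega>) - (- g 0 \<omega>))\<^sup>2)"
    by (rule integrable_square_diff[OF _ _ d]) (use poly_closureD(2)[OF g, of 0] in auto)
  then have "integrable M (\<lambda>\<omega>. (f \<omega>)\<^sup>2)" by simp
  then show ?thesis
  proof (rule poly_closure_closed[rotated])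
    fix e :: real assume "e > 0"
    then have "\<forall>\<^sub>F n in sequentially. (\<integral>\<omega>. (f \<omega> - g n \<omega>)\<^sup>2 \<partial>M) < e"
      by (intro order_tendstoD(2)[OF tends])
    then show "\<exists>g\<in>poly_closure M Y. (\<integral>\<omega>. (f \<omega> - g \<omega>)\<^sup>2 \<partial>M) < e"
      using g by (auto simp: eventually_sequentially)
  qed simp
qed

lemma poly_closure_add:
  assumes f: "f \<in> poly_closure M Y" and g: "g \<in> poly_closure M Y"
  shows "(\<lambda>\<omega>. f \<omega> + g \<omega>) \<in> poly_closure M Y"
proof -
  note [measurable] = poly_closureD(1)[OF f] poly_closureD(1)[OF g]
  have fg2: "integrable M (\<lambda>\<omega>. (f \<omega> + g \<omega>)\<^sup>2)"
    using integrable_square_diff[of f M "\<lambda>\<omega>. - g \<omega>"] poly_closureD(2)[OF f] poly_closureD(2)[OF g] by simp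
  have "\<exists>p. (\<integral>\<omega>. (f \<omega> + g \<omega> - poly p (Y \<omega>))\<^sup>2 \<partial>M) < e" if "e > 0" for e
  proof -
    obtain p where p: "(\<integral>\<omega>. (f \<omega> - poly p (Y \<omega>))\<^sup>2 \<partial>M) < e/4"
      using poly_closureD(3)[OF f, of "e/4"] \<open>e > 0\<close> by auto
    obtain q where q: "(\<integral>\<omega>. (g \<omega> - poly q (Y \<omega>))\<^sup>2 \<partial>M) < e/4"
      using poly_closureD(3)[OF g, of "e/4"] \<open>e > 0\<close> by auto
    have *: "integrable M (\<lambda>\<omega>. (f \<omega> - poly p (Y \<omega>))\<^sup>2)" "integrable M (\<lambda>\<omega>. (g \<omega> - poly q (Y \<omega>))\<^sup>2)"
      using poly_closureD(2)[OF f] poly_closureD(2)[OF g] by (auto intro!: integrable_square_diff poly_sq)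
    have "(f \<omega> + g \<omega> - poly (p + q) (Y \<omega>))\<^sup>2 \<le> 2 * (f \<omega> - poly p (Y \<omega>))\<^sup>2 + 2 * (g \<omega> - poly q (Y \<omega>))\<^sup>2" for \<omega>
      using zero_le_power2[of "(f \<omega> - poly p (Y \<omega>)) - (g \<omega> - poly q (Y \<omega>))"]
      by (simp add: power2_eq_square algebra_simps)
    then have "(\<integral>\<omega>. (f \<omega> + g \<omega> - poly (p + q) (Y \<omega>))\<^sup>2 \<partial>M)
        \<le> (\<integral>\<omega>. 2 * (f \<omega> - poly p (Y \<omega>))\<^sup>2 + 2 * (g \<omega> - poly q (Y \<omega>))\<^sup>2 \<partial>M)"
      using * fg2 poly_sq by (intro integral_mono integrable_square_diff) (auto simp del: poly_add)
    also have "\<dots> < e" using * p q by simp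
    finally show ?thesis ..
  qed
  then show ?thesis using fg2 by (auto simp: poly_closure_def)
qed

lemma poly_closure_sum:
  assumes "finite I" "\<And>i. i \<in> I \<Longrightarrow> f i \<in> poly_closure M Y"
  shows "(\<lambda>\<omega>. \<Sum>i\<in>I. f i \<omega>) \<in> poly_closure M Y"
  using assms
proof (induction I)
  case empty
  then show ?case using poly_closure_poly[of 0] by simp
next
  case (insert i I)
  then show ?case using poly_closure_add[of "f i" "\<lambda>\<omega>. \<Sum>i\<in>I. f i \<omega>"] by simp
qed

text \<open>Multiplication by \<open>sin (\<xi> Y)\<close> preserves the closure: the Taylor polynomials converge to it
  dominated by \<open>exp (\<xi> \<bar>Y\<bar>)\<close>, and the remaining factors are bounded by \<open>1\<close>.\<close>

lemma poly_closure_sin_power: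
  assumes \<xi>: "4 * \<bar>\<xi>\<bar> \<le> c"
  shows "(\<lambda>\<omega>. sin (\<xi> * Y \<omega>) ^ m * poly p (Y \<omega>)) \<in> poly_closure M Y"
proof (induction m arbitrary: p)
  case 0
  show ?case using poly_closure_poly by simp
next
  case (Suc m)
  \<comment> \<open>The exponent \<open>c\<close> is split in two: one half bounds the square of
    \<open>p\<close>, the other the squared Taylor error, which grows like
    \<open>exp (2 * \<bar>\<xi>\<bar> * \<bar>y\<bar>)\<close> with 2\<bar>\<xi>\<bar> \<le>
    c/2.\<close>
  obtain K where K: "\<And>y. \<bar>poly (p * p) y\<bar> \<le> K * exp (c/2 * \<bar>y\<bar>)"
    using abs_poly_le_exp[of "c/2" "p * p"] c_pos by (auto simp del: poly_mult)
  show ?case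
  proof (rule poly_closure_limit[where w = "\<lambda>\<omega>. 4 * K * exp (c * \<bar>Y \<omega>\<bar>)"])
    \<comment> \<open>One sine factor is replaced by its Taylor polynomial, which merges with
      \<open>p\<close>; this is why the induction is over all \<open>p\<close>.\<close>
    show "(\<lambda>\<omega>. sin (\<xi> * Y \<omega>) ^ m * poly (sin_taylor \<xi> n * p) (Y \<omega>)) \<in> poly_closure M Y" for n
      by (rule Suc.IH)
    show "(\<lambda>n. sin (\<xi> * Y \<omega>) ^ m * poly (sin_taylor \<xi> n * p) (Y \<omega>))
        \<longlonglongrightarrow> sin (\<xi> * Y \<omega>) ^ Suc m * poly p (Y \<omega>)" for \<omega>
      by (auto intro!: tendsto_eq_intros sin_taylor_tendsto)
    show "integrable M (\<lambda>\<omega>. 4 * K * exp (c * \<bar>Y \<omega>\<bar>))"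
      using exp_int by auto
    show "(sin (\<xi> * Y \<omega>) ^ Suc m * poly p (Y \<omega>)
        - sin (\<xi> * Y \<omega>) ^ m * poly (sin_taylor \<xi> n * p) (Y \<omega>))\<^sup>2 \<le> 4 * K * exp (c * \<bar>Y \<omega>\<bar>)" for n \<omega>
    proof -
      define s t q E where "s = sin (\<xi> * Y \<omega>)" and "t = poly (sin_taylor \<xi> n) (Y \<omega>)"
        and "q = poly p (Y \<omega>)" and "E = exp (\<bar>\<xi>\<bar> * \<bar>Y \<omega>\<bar>)"
      have "E \<ge> 1" by (simp add: E_def)
      have s: "\<bar>s\<bar> \<le> 1" by (simp add: s_def)
      have t: "\<bar>t\<bar> \<le> E" by (simp add: t_def E_def abs_sin_taylor_le)
      have "\<bar>s - t\<bar> \<le> 2 * E" using s t \<open>E \<ge> 1\<close> by linarith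
      then have st: "(s - t)\<^sup>2 \<le> 4 * E\<^sup>2"
        using power_mono[of "\<bar>s - t\<bar>" "2 * E" 2] by (simp add: power_mult_distrib)
      have E: "E\<^sup>2 \<le> exp (c/2 * \<bar>Y \<omega>\<bar>)"
        using mult_right_mono[OF \<xi>, of "\<bar>Y \<omega>\<bar>"] by (simp add: E_def flip: exp_double)
      have q: "q\<^sup>2 \<le> K * exp (c/2 * \<bar>Y \<omega>\<bar>)"
        using K[of "Y \<omega>"] by (simp add: q_def power2_eq_square)
      have "(s ^ Suc m * q - s ^ m * (t * q))\<^sup>2 = (s\<^sup>2) ^ m * ((s - t)\<^sup>2 * q\<^sup>2)"
        by (simp add: power2_eq_square algebra_simps power_mult_distrib)
      also have "\<dots> \<le> 1 * ((4 * exp (c/2 * \<bar>Y \<omega>\<bar>)) * (K * exp (c/2 * \<bar>Y \<omega>\<bar>)))"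
      proof (intro mult_mono)
        show "(s\<^sup>2) ^ m \<le> 1" using s power_le_one[of "s\<^sup>2" m] by (simp add: abs_square_le_1)
        show "(s - t)\<^sup>2 \<le> 4 * exp (c/2 * \<bar>Y \<omega>\<bar>)" using st E by linarith
      qed (use q in auto)
      also have "\<dots> = 4 * K * exp (c * \<bar>Y \<omega>\<bar>)" by (simp flip: exp_add)
      finally show ?thesis by (simp add: s_def t_def q_def)
    qed
  qed measurable
qed

text \<open>For \<open>k\<close> large, \<open>k * sin (Y / k)\<close> is close to \<open>Y\<close> and stays in \<open>[-k, k]\<close>, where the
  Weierstrass theorem applies; this reduces a bounded continuous function to powers of a sine.\<close>

lemma poly_closure_bounded_continuous:
  fixes f :: "real \<Rightarrow> real"
  assumes f: "continuous_on UNIV f" and B: "\<And>y. \<bar>f y\<bar> \<le> B"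
  shows "(\<lambda>\<omega>. f (Y \<omega>)) \<in> poly_closure M Y"
proof -
  have [measurable]: "f \<in> borel_measurable borel"
    using f by (rule borel_measurable_continuous_onI)
  \<comment> \<open>The shift by \<open>k0\<close> makes every frequency \<open>1 / k n\<close>
    small enough for the lemma on powers of the sine.\<close>
  obtain k0 :: nat where k0: "4 / c < k0" using reals_Archimedean2 by blast
  define k where "k n = real (n + k0 + 1)" for n
  have k_pos: "k n > 0" for n by (simp add: k_def)
  have k_big: "4 * \<bar>1 / k n\<bar> \<le> c" for n
  proof -
    have "4 / c \<le> k n" using k0 by (simp add: k_def)
    then show ?thesis using c_pos k_pos[of n] by (simp add: field_simps)
  qed
  have inner: "(\<lambda>\<omega>. f (k n * sin (Y \<omega> / k n))) \<in> poly_closure M Y" for n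
  proof (rule poly_closure_closed)
    have "(f y)\<^sup>2 \<le> B\<^sup>2" for y
      using power_mono[OF B abs_ge_zero, of y 2] by simp
    then show "integrable M (\<lambda>\<omega>. (f (k n * sin (Y \<omega> / k n)))\<^sup>2)"
      by (intro integrable_const_bound[of _ "B\<^sup>2"] AE_I2) auto
    fix e :: real assume "e > 0"
    \<comment> \<open>Uniform accuracy \<open>sqrt (e/2)\<close> gives mean squared error at most
      \<open>e/2\<close> on a probability space, strictly below \<open>e\<close>.\<close>
    then obtain g where g: "real_polynomial_function g"
      "\<And>x. x \<in> {- k n..k n} \<Longrightarrow> \<bar>f x - g x\<bar> < sqrt (e/2)"
      using Stone_Weierstrass_real_polynomial_function[of "{- k n..k n}" f "sqrt (e/2)"]
        continuous_on_subset[OF f] by auto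
    from g(1) obtain a m where a: "g = (\<lambda>x. \<Sum>i\<le>m. a i * x ^ i)"
      by (auto simp: real_polynomial_function_iff_sum)
    have cl: "(\<lambda>\<omega>. g (k n * sin (Y \<omega> / k n))) \<in> poly_closure M Y"
    proof -
      \<comment> \<open>A monomial in the scaled sine is a power of the sine times the constant
        polynomial \<open>a i * k n ^ i\<close>.\<close>
      have "(\<lambda>\<omega>. a i * (k n * sin (Y \<omega> / k n)) ^ i) \<in> poly_closure M Y" for i
        using poly_closure_sin_power[OF k_big[of n], of i "[:a i * k n ^ i:]"]
        by (simp add: power_mult_distrib mult_ac)
      then show ?thesis unfolding a by (intro poly_closure_sum) auto
    qed
    have [measurable]: "(\<lambda>\<omega>. g (k n * sin (Y \<omega> / k n))) \<in> borel_measurable M"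
      by (rule poly_closureD(1)[OF cl])
    have bd: "(f (k n * sin (Y \<omega> / k n)) - g (k n * sin (Y \<omega> / k n)))\<^sup>2 \<le> e/2" for \<omega>
    proof -
      have "\<bar>k n * sin (Y \<omega> / k n)\<bar> \<le> k n * 1"
        unfolding abs_mult using k_pos[of n] by (intro mult_mono) auto
      then have "\<bar>f (k n * sin (Y \<omega> / k n)) - g (k n * sin (Y \<omega> / k n))\<bar> < sqrt (e/2)"
        by (intro g(2)) auto
      then show ?thesis
        using power_mono[of "\<bar>f (k n * sin (Y \<omega> / k n)) - g (k n * sin (Y \<omega> / k n))\<bar>" "sqrt (e/2)" 2] \<open>e > 0\<close>
        by simp
    qed
    have "(\<integral>\<omega>. (f (k n * sin (Y \<omega> / k n)) - g (k n * sin (Y \<omega> / k n)))\<^sup>2 \<partial>M) \<le> (\<integral>\<omega>. e/2 \<partial>M)"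
      using bd \<open>e > 0\<close> by (intro integral_mono integrable_const_bound[of _ "e/2"]) auto
    also have "\<dots> < e" using \<open>e > 0\<close> by (simp add: prob_space)
    finally show "\<exists>h\<in>poly_closure M Y. (\<integral>\<omega>. (f (k n * sin (Y \<omega> / k n)) - h \<omega>)\<^sup>2 \<partial>M) < e"
      using cl by (intro bexI[of _ "\<lambda>\<omega>. g (k n * sin (Y \<omega> / k n))"])
  qed measurable
  show ?thesis
  proof (rule poly_closure_limit[where g = "\<lambda>n \<omega>. f (k n * sin (Y \<omega> / k n))" and w = "\<lambda>_. (2 * B)\<^sup>2"])
    fix \<omega>
    have "(\<lambda>n. k n * sin (Y \<omega> / k n)) \<longlonglongrightarrow> Y \<omega>"
    proof -
      have "((\<lambda>x. x * sin (y / x)) \<longlongrightarrow> y) at_top" for y :: real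
        by real_asymp
      moreover have "filterlim k at_top sequentially"
        unfolding k_def by real_asymp
      ultimately show ?thesis by (rule filterlim_compose)
    qed
    then show "(\<lambda>n. f (k n * sin (Y \<omega> / k n))) \<longlonglongrightarrow> f (Y \<omega>)"
      using f continuous_on_tendsto_compose[of UNIV f] by simp
  next
    fix n \<omega>
    have "\<bar>f (Y \<omega>) - f (k n * sin (Y \<omega> / k n))\<bar> \<le> 2 * B"
      using B[of "Y \<omega>"] B[of "k n * sin (Y \<omega> / k n)"] by linarith
    then show "(f (Y \<omega>) - f (k n * sin (Y \<omega> / k n)))\<^sup>2 \<le> (2 * B)\<^sup>2"
      using power_mono[OF _ abs_ge_zero, of "f (Y \<omega>) - f (k n * sin (Y \<omega> / k n))" "2 * B" 2] by simp
  qed (use inner in auto)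
qed

text \<open>Truncation of the values at height \<open>n\<close> reduces this to the bounded case.
  Truncating moves a value towards 0 and not past it, so the squared error is dominated by the
  square of \<open>f\<close>.\<close>

lemma poly_closure_continuous:
  fixes f :: "real \<Rightarrow> real"
  assumes f: "continuous_on UNIV f" and f2: "integrable M (\<lambda>\<omega>. (f (Y \<omega>))\<^sup>2)"
  shows "(\<lambda>\<omega>. f (Y \<omega>)) \<in> poly_closure M Y"
proof -
  have [measurable]: "f \<in> borel_measurable borel"
    using f by (rule borel_measurable_continuous_onI)
  define g where "g n y = max (- real n) (min (real n) (f y))" for n y
  show ?thesis
  proof (rule poly_closure_limit[where g = "\<lambda>n \<omega>. g n (Y \<omega>)" and w = "\<lambda>\<omega>. (f (Y \<omega>))\<^sup>2"])
    show "(\<lambda>\<omega>. g n (Y \<omega>)) \<in> poly_closure M Y" for n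
    proof (rule poly_closure_bounded_continuous[of _ "real n"])
      show "continuous_on UNIV (g n)"
        unfolding g_def using f by (intro continuous_intros)
    qed (auto simp: g_def)
    show "(\<lambda>n. g n (Y \<omega>)) \<longlonglongrightarrow> f (Y \<omega>)" for \<omega>
    proof (rule tendsto_eventually)
      obtain n0 :: nat where "\<bar>f (Y \<omega>)\<bar> \<le> n0" using real_arch_simple by blast
      then have "g n (Y \<omega>) = f (Y \<omega>)" if "n \<ge> n0" for n
        using that by (auto simp: g_def)
      then show "\<forall>\<^sub>F n in sequentially. g n (Y \<omega>) = f (Y \<omega>)"
        by (auto simp: eventually_sequentially)
    qed
    show "(f (Y \<omega>) - g n (Y \<omega>))\<^sup>2 \<le> (f (Y \<omega>))\<^sup>2" for n \<omega>
      unfolding abs_le_square_iff[symmetric] g_def by (auto simp: max_def min_def)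
  qed (use f2 in auto)
qed

end

section \<open>The conditional expectation in Gaussian noise\<close>

locale gaussian_channel = prob_space M for M :: "'a measure" +
  fixes X N :: "'a \<Rightarrow> real"
  assumes X [measurable]: "X \<in> borel_measurable M"
    and N_distr: "distributed M lborel N std_normal_density"
    and indep: "indep_var borel X borel N"
begin

lemma N [measurable]: "N \<in> borel_measurable M"
  using distributed_measurable[OF N_distr] by simp

definition PX :: "real measure" where
  "PX = distr M borel X"

lemma sets_PX [simp, measurable_cong]: "sets PX = sets borel"
  by (simp add: PX_def)

lemma space_PX [simp]: "space PX = UNIV"
  by (simp add: PX_def)

sublocale PX: prob_space PX
  unfolding PX_def by (rule prob_space_distr) measurable

sublocale lborel_PX: pair_sigma_finite lborel PX ..

section \<open>The joint law of output and input\<close>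

text \<open>Given X = x the output is Gaussian around \<open>s * x\<close>. Since X may be discrete
  or singular, the reference measure is Lebesgue measure times the law of X.\<close>

lemma joint_distr:
  "distr M (borel \<Otimes>\<^sub>M borel) (\<lambda>\<omega>. (s * X \<omega> + N \<omega>, X \<omega>)) =
     density (lborel \<Otimes>\<^sub>M PX) (\<lambda>(y, x). ennreal (std_normal_density (y - s * x)))"
proof (rule measure_eqI)
  show "sets (distr M (borel \<Otimes>\<^sub>M borel) (\<lambda>\<omega>. (s * X \<omega> + N \<omega>, X \<omega>))) =
      sets (density (lborel \<Otimes>\<^sub>M PX) (\<lambda>(y, x). ennreal (std_normal_density (y - s * x))))"
    by (simp cong: sets_pair_measure_cong)
next
  fix A assume "A \<in> sets (distr M (borel \<Otimes>\<^sub>M borel) (\<lambda>\<omega>. (s * X \<omega> + N \<omega>, X \<omega>)))"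
  then have A [measurable]: "A \<in> sets (borel \<Otimes>\<^sub>M borel)" by simp
  have A' [measurable]: "A \<in> sets (lborel \<Otimes>\<^sub>M PX)"
    using A by (simp cong: sets_pair_measure_cong)
  have NN: "distr M borel N = density lborel std_normal_density"
    using N_distr unfolding distributed_def by (metis distr_cong sets_lborel)
  interpret NN: prob_space "density lborel std_normal_density"
    by (rule prob_space_normal_density) simp
  have "emeasure (distr M (borel \<Otimes>\<^sub>M borel) (\<lambda>\<omega>. (s * X \<omega> + N \<omega>, X \<omega>))) A
      = (\<integral>\<^sup>+p. indicator A p \<partial>distr M (borel \<Otimes>\<^sub>M borel) (\<lambda>\<omega>. (s * X \<omega> + N \<omega>, X \<omega>)))"
    by simp
  also have "\<dots> = (\<integral>\<^sup>+\<omega>. indicator A (s * X \<omega> + N \<omega>, X \<omega>) \<partial>M)"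
    by (subst nn_integral_distr) measurable
  also have "\<dots> = (\<integral>\<^sup>+p. indicator A (s * fst p + snd p, fst p)
      \<partial>distr M (borel \<Otimes>\<^sub>M borel) (\<lambda>\<omega>. (X \<omega>, N \<omega>)))"
    by (subst nn_integral_distr) simp_all
  also have "distr M (borel \<Otimes>\<^sub>M borel) (\<lambda>\<omega>. (X \<omega>, N \<omega>)) = PX \<Otimes>\<^sub>M density lborel std_normal_density"
    using indep by (simp add: indep_var_distribution_eq PX_def NN)
  also have "(\<integral>\<^sup>+p. indicator A (s * fst p + snd p, fst p) \<partial>(PX \<Otimes>\<^sub>M density lborel std_normal_density))
      = (\<integral>\<^sup>+x. \<integral>\<^sup>+n. indicator A (s * x + n, x) \<partial>density lborel std_normal_density \<partial>PX)"
    by (subst NN.nn_integral_fst[symmetric]) simp_all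
  also have "\<dots> = (\<integral>\<^sup>+x. \<integral>\<^sup>+n. ennreal (std_normal_density n) * indicator A (s * x + n, x) \<partial>lborel \<partial>PX)"
    by (subst nn_integral_density) simp_all
  also have "\<dots> = (\<integral>\<^sup>+x. \<integral>\<^sup>+y. ennreal (std_normal_density (y - s * x)) * indicator A (y, x) \<partial>lborel \<partial>PX)"
  proof (rule nn_integral_cong)
    fix x
    show "(\<integral>\<^sup>+n. ennreal (std_normal_density n) * indicator A (s * x + n, x) \<partial>lborel)
        = (\<integral>\<^sup>+y. ennreal (std_normal_density (y - s * x)) * indicator A (y, x) \<partial>lborel)"
      \<comment> \<open>The translation from \<open>n\<close> to \<open>y = s * x + n\<close>, for
        fixed \<open>x\<close>.\<close>
      by (subst nn_integral_real_affine[where c = 1 and t = "- s * x"]) simp_all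
  qed
  also have "\<dots> = (\<integral>\<^sup>+p. ennreal (std_normal_density (fst p - s * snd p)) * indicator A p \<partial>(lborel \<Otimes>\<^sub>M PX))"
    by (subst lborel_PX.nn_integral_snd[symmetric]) simp_all
  also have "\<dots> = emeasure (density (lborel \<Otimes>\<^sub>M PX) (\<lambda>(y, x). ennreal (std_normal_density (y - s * x)))) A"
    by (subst emeasure_density) (simp_all add: split_beta)
  finally show "emeasure (distr M (borel \<Otimes>\<^sub>M borel) (\<lambda>\<omega>. (s * X \<omega> + N \<omega>, X \<omega>))) A =
      emeasure (density (lborel \<Otimes>\<^sub>M PX) (\<lambda>(y, x). ennreal (std_normal_density (y - s * x)))) A" .
qed

text \<open>Expectations move to a product measure, where Fubini can integrate out the input while
  the output stays fixed.\<close>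

lemma
  fixes f :: "real \<times> real \<Rightarrow> real"
  assumes [measurable]: "f \<in> borel_measurable (borel \<Otimes>\<^sub>M borel)"
  shows integrable_joint_iff: "integrable M (\<lambda>\<omega>. f (s * X \<omega> + N \<omega>, X \<omega>)) \<longleftrightarrow>
      integrable (lborel \<Otimes>\<^sub>M PX) (\<lambda>p. std_normal_density (fst p - s * snd p) * f p)" (is ?int)
    and integral_joint_eq: "(\<integral>\<omega>. f (s * X \<omega> + N \<omega>, X \<omega>) \<partial>M) =
      (\<integral>p. std_normal_density (fst p - s * snd p) * f p \<partial>(lborel \<Otimes>\<^sub>M PX))" (is ?eq)
proof -
  have [measurable]: "f \<in> borel_measurable (lborel \<Otimes>\<^sub>M PX)"
    using assms by (simp cong: measurable_cong_sets sets_pair_measure_cong)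
  have "integrable M (\<lambda>\<omega>. f (s * X \<omega> + N \<omega>, X \<omega>)) \<longleftrightarrow>
      integrable (density (lborel \<Otimes>\<^sub>M PX) (\<lambda>p. ennreal (std_normal_density (fst p - s * snd p)))) f"
    by (subst integrable_distr_eq[of "\<lambda>\<omega>. (s * X \<omega> + N \<omega>, X \<omega>)" M "borel \<Otimes>\<^sub>M borel" f, symmetric])
      (simp_all add: joint_distr split_beta')
  also have "\<dots> \<longleftrightarrow> integrable (lborel \<Otimes>\<^sub>M PX) (\<lambda>p. std_normal_density (fst p - s * snd p) * f p)"
    by (subst integrable_density) simp_all
  finally show ?int .
  have "(\<integral>\<omega>. f (s * X \<omega> + N \<omega>, X \<omega>) \<partial>M) =
      (\<integral>p. f p \<partial>density (lborel \<Otimes>\<^sub>M PX) (\<lambda>p. ennreal (std_normal_density (fst p - s * snd p))))"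
    by (subst integral_distr[of "\<lambda>\<omega>. (s * X \<omega> + N \<omega>, X \<omega>)" M "borel \<Otimes>\<^sub>M borel" f, symmetric])
      (simp_all add: joint_distr split_beta')
  also have "\<dots> = (\<integral>p. std_normal_density (fst p - s * snd p) * f p \<partial>(lborel \<Otimes>\<^sub>M PX))"
    by (subst integral_density) simp_all
  finally show ?eq .
qed

section \<open>The posterior mean as a ratio of Gaussian averages\<close>

definition num :: "real \<Rightarrow> real \<Rightarrow> real" where
  "num s y = (\<integral>\<omega>. X \<omega> * std_normal_density (y - s * X \<omega>) \<partial>M)"

definition den :: "real \<Rightarrow> real \<Rightarrow> real" where
  "den s y = (\<integral>\<omega>. std_normal_density (y - s * X \<omega>) \<partial>M)"

text \<open>Bayes' formula for the conditional mean of X given the output value \<open>y\<close>;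
  \<open>den s\<close> is the Lebesgue density of the output.\<close>

definition post :: "real \<Rightarrow> real \<Rightarrow> real" where
  "post s y = num s y / den s y"

lemma std_normal_density_le_1: "std_normal_density x \<le> 1"
proof -
  have "1 / sqrt (2 * pi) * exp (- x\<^sup>2 / 2) \<le> 1 * 1"
    using pi_ge_two by (intro mult_mono) (auto simp: divide_simps)
  then show ?thesis by (simp add: std_normal_density_def)
qed

lemma integrable_density_X: "integrable M (\<lambda>\<omega>. std_normal_density (y - s * X \<omega>))"
  by (rule integrable_const_bound[of _ 1]) (auto simp: std_normal_density_le_1)

text \<open>The integrand is strictly positive everywhere, so a zero integral would force it to
  vanish almost everywhere on a probability space.\<close>

lemma den_pos: "0 < den s y"
proof -
  have pos: "0 < std_normal_density x" for x by (simp add: normal_density_pos)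
  have "den s y \<noteq> 0"
  proof
    assume "den s y = 0"
    then have "AE \<omega> in M. std_normal_density (y - s * X \<omega>) = 0"
      unfolding den_def by (subst (asm) integral_nonneg_eq_0_iff_AE) (auto simp: integrable_density_X)
    then have "AE \<omega> in M. False"
      by eventually_elim (use pos in \<open>metis less_irrefl\<close>)
    then show False by simp
  qed
  moreover have "0 \<le> den s y" unfolding den_def by (rule integral_nonneg_AE) auto
  ultimately show ?thesis by simp
qed

text \<open>Dominated convergence in numerator and denominator, with bounds \<bar>X\<bar> and 1.
  Both arguments move, because in the semicontinuity argument the observation \<open>y\<close>
  changes together with \<open>s\<close>.\<close>

lemma post_tendsto:
  assumes XI: "integrable M X" and s: "s \<longlonglongrightarrow> s0" and y: "y \<longlonglongrightarrow> y0"
  shows "(\<lambda>k::nat. post (s k) (y k)) \<longlonglongrightarrow> post s0 y0"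
proof -
  have lim: "(\<lambda>k. std_normal_density (y k - s k * x)) \<longlonglongrightarrow> std_normal_density (y0 - s0 * x)" for x
    unfolding std_normal_density_def by (intro tendsto_intros s y) auto
  have "(\<lambda>k. num (s k) (y k)) \<longlonglongrightarrow> num s0 y0"
    unfolding num_def
  proof (rule integral_dominated_convergence[where w = "\<lambda>\<omega>. \<bar>X \<omega>\<bar>"])
    show "AE \<omega> in M. norm (X \<omega> * std_normal_density (y k - s k * X \<omega>)) \<le> \<bar>X \<omega>\<bar>" for k
      by (auto simp: abs_mult intro!: AE_I2 mult_left_le std_normal_density_le_1)
  qed (use XI in \<open>auto intro!: AE_I2 tendsto_mult lim\<close>)
  moreover have "(\<lambda>k. den (s k) (y k)) \<longlonglongrightarrow> den s0 y0"
    unfolding den_def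
    by (rule integral_dominated_convergence[where w = "\<lambda>_. 1"])
       (auto intro!: AE_I2 lim std_normal_density_le_1)
  ultimately show ?thesis
    unfolding post_def using den_pos[of s0 y0] by (intro tendsto_divide) auto
qed

lemma continuous_post: "integrable M X \<Longrightarrow> continuous_on UNIV (post s)"
  by (auto simp: continuous_on_sequentially o_def intro!: post_tendsto)

text \<open>Integrating out the input for a fixed output \<open>y\<close> gives
  \<open>num s y\<close> for X and \<open>den s y * post s y\<close> for the candidate, and these
  agree. So both have the same integral over every event determined by the output.\<close>

lemma AE_cond_exp_eq_post:
  assumes XI: "integrable M X"
  defines "Y \<equiv> \<lambda>s \<omega>. s * X \<omega> + N \<omega>"
  shows "AE \<omega> in M. real_cond_exp M (vimage_algebra (space M) (Y s) borel) X \<omega> = post s (Y s \<omega>)"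
proof -
  let ?\<phi> = std_normal_density
  have Y [measurable]: "Y s \<in> borel_measurable M" unfolding Y_def by measurable
  have post [measurable]: "post s \<in> borel_measurable borel"
    by (rule borel_measurable_continuous_onI[OF continuous_post[OF XI]])
  define F where "F = vimage_algebra (space M) (Y s) borel"
  interpret F: finite_measure_subalgebra M F
    by standard (auto simp: F_def subalgebra_def sets_vimage_algebra2)
  have num_eq: "num s y = (\<integral>x. ?\<phi> (y - s * x) * x \<partial>PX)" for y
    unfolding num_def PX_def by (subst integral_distr) (auto simp: mult.commute)
  have den_eq: "den s y = (\<integral>x. ?\<phi> (y - s * x) \<partial>PX)" for y
    unfolding den_def PX_def by (subst integral_distr) auto
  have int_x: "integrable (lborel \<Otimes>\<^sub>M PX) (\<lambda>p. ?\<phi> (fst p - s * snd p) * snd p)"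
    using integrable_joint_iff[of snd s] XI by simp
  \<comment> \<open>Integrating the absolute value over the input leaves \<bar>num s y\<bar>, which
    is integrable in \<open>y\<close> by Fubini applied to \<open>int_x\<close>.\<close>
  have int_post: "integrable (lborel \<Otimes>\<^sub>M PX) (\<lambda>p. ?\<phi> (fst p - s * snd p) * post s (fst p))"
  proof (rule lborel_PX.Fubini_integrable)
    have "(\<integral>x. norm (?\<phi> (y - s * x) * post s y) \<partial>PX) = \<bar>num s y\<bar>" for y
    proof -
      have "(\<integral>x. norm (?\<phi> (y - s * x) * post s y) \<partial>PX) = (\<integral>x. ?\<phi> (y - s * x) \<partial>PX) * \<bar>post s y\<bar>"
        by (simp add: abs_mult)
      also have "\<dots> = \<bar>num s y\<bar>"
        using den_pos[of s y] by (simp add: post_def flip: den_eq)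
      finally show ?thesis .
    qed
    moreover have "integrable lborel (\<lambda>y. \<bar>num s y\<bar>)"
      using lborel_PX.integrable_fst'[OF int_x] by (simp add: num_eq)
    ultimately show "integrable lborel (\<lambda>y. \<integral>x. norm (?\<phi> (fst (y, x) - s * snd (y, x)) * post s (fst (y, x))) \<partial>PX)"
      by simp
    show "AE y in lborel. integrable PX (\<lambda>x. ?\<phi> (fst (y, x) - s * snd (y, x)) * post s (fst (y, x)))"
      by (auto intro!: AE_I2 PX.integrable_const_bound[of _ 1] std_normal_density_le_1)
  qed measurable
  have "AE \<omega> in M. real_cond_exp M F X \<omega> = post s (Y s \<omega>)"
  proof (rule F.real_cond_exp_charact)
    show "integrable M (\<lambda>\<omega>. post s (Y s \<omega>))"
      using integrable_joint_iff[of "\<lambda>p. post s (fst p)" s] int_post by (simp add: Y_def)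
    have "Y s \<in> F \<rightarrow>\<^sub>M borel"
      unfolding F_def by (rule measurable_vimage_algebra1) simp
    then show "(\<lambda>\<omega>. post s (Y s \<omega>)) \<in> borel_measurable F" by simp
    fix A assume "A \<in> sets F"
    \<comment> \<open>An event of \<open>F\<close> is a preimage under the output, so its indicator
      depends on \<open>y\<close> alone and factors out of the inner integral.\<close>
    then obtain B where B [measurable]: "B \<in> sets borel" and A: "A = Y s -` B \<inter> space M"
      by (auto simp: F_def sets_vimage_algebra2)
    have "(\<integral>\<omega>\<in>A. X \<omega> \<partial>M) = (\<integral>\<omega>. indicator B (Y s \<omega>) * X \<omega> \<partial>M)"
      unfolding set_lebesgue_integral_def A by (rule Bochner_Integration.integral_cong) (auto split: split_indicator)
    also have "\<dots> = (\<integral>p. ?\<phi> (fst p - s * snd p) * (indicator B (fst p) * snd p) \<partial>(lborel \<Otimes>\<^sub>M PX))"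
      using integral_joint_eq[of "\<lambda>p. indicator B (fst p) * snd p" s] by (simp add: Y_def)
    also have "\<dots> = (\<integral>y. \<integral>x. ?\<phi> (y - s * x) * (indicator B y * x) \<partial>PX \<partial>lborel)"
      by (subst lborel_PX.integral_fst'[symmetric])
         (auto intro!: Bochner_Integration.integrable_bound[OF int_x] split: split_indicator)
    also have "\<dots> = (\<integral>y. \<integral>x. ?\<phi> (y - s * x) * (indicator B y * post s y) \<partial>PX \<partial>lborel)"
    proof (rule Bochner_Integration.integral_cong[OF refl])
      fix y
      have "(\<integral>x. ?\<phi> (y - s * x) * (indicator B y * x) \<partial>PX) = indicator B y * num s y"
        unfolding num_eq by (auto split: split_indicator)
      also have "\<dots> = indicator B y * (den s y * post s y)"
        using den_pos[of s y] by (simp add: post_def)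
      also have "\<dots> = (\<integral>x. ?\<phi> (y - s * x) * (indicator B y * post s y) \<partial>PX)"
        by (simp add: den_eq)
      finally show "(\<integral>x. ?\<phi> (y - s * x) * (indicator B y * x) \<partial>PX)
          = (\<integral>x. ?\<phi> (y - s * x) * (indicator B y * post s y) \<partial>PX)" .
    qed
    also have "\<dots> = (\<integral>p. ?\<phi> (fst p - s * snd p) * (indicator B (fst p) * post s (fst p)) \<partial>(lborel \<Otimes>\<^sub>M PX))"
      by (subst lborel_PX.integral_fst'[symmetric])
         (auto intro!: Bochner_Integration.integrable_bound[OF int_post] split: split_indicator)
    also have "\<dots> = (\<integral>\<omega>. indicator B (Y s \<omega>) * post s (Y s \<omega>) \<partial>M)"
      using integral_joint_eq[of "\<lambda>p. indicator B (fst p) * post s (fst p)" s] by (simp add: Y_def)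
    also have "\<dots> = (\<integral>\<omega>\<in>A. post s (Y s \<omega>) \<partial>M)"
      unfolding set_lebesgue_integral_def A by (rule Bochner_Integration.integral_cong) (auto split: split_indicator)
    finally show "(\<integral>\<omega>\<in>A. X \<omega> \<partial>M) = (\<integral>\<omega>\<in>A. post s (Y s \<omega>) \<partial>M)" .
  qed (rule XI)
  then show ?thesis by (simp add: F_def)
qed

end

section \<open>Uniform convergence of the gap\<close>

text \<open>Fatou's lemma, stated with a bound \<open>K\<close> that holds eventually, the form in
  which lower semicontinuity is used below.\<close>

lemma integral_le_of_tendsto:
  fixes u :: "nat \<Rightarrow> 'a \<Rightarrow> real"
  assumes u: "\<And>k. integrable M (u k)" "\<And>k x. 0 \<le> u k x" and v: "integrable M v"
    and lim: "\<And>x. (\<lambda>k. u k x) \<longlonglongrightarrow> v x"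
    and K: "\<forall>\<^sub>F k in sequentially. (\<integral>x. u k x \<partial>M) \<le> K"
  shows "(\<integral>x. v x \<partial>M) \<le> K"
proof -
  have v0: "0 \<le> v x" for x
    by (rule LIMSEQ_le_const[OF lim]) (use u in auto)
  \<comment> \<open>\<open>ennreal\<close> sends negative numbers to 0, so the final comparison
    returns to the reals only for a nonnegative \<open>K\<close>.\<close>
  obtain k where "(\<integral>x. u k x \<partial>M) \<le> K" using K by (auto simp: eventually_sequentially)
  moreover have "0 \<le> (\<integral>x. u k x \<partial>M)" using u by (intro integral_nonneg_AE) auto
  ultimately have "0 \<le> K" by linarith
  have "ennreal (\<integral>x. v x \<partial>M) = (\<integral>\<^sup>+x. ennreal (v x) \<partial>M)"
    using v v0 by (intro nn_integral_eq_integral[symmetric]) auto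
  also have "\<dots> = (\<integral>\<^sup>+x. liminf (\<lambda>k. ennreal (u k x)) \<partial>M)"
    using lim by (intro nn_integral_cong lim_imp_Liminf[symmetric] tendsto_ennrealI) auto
  also have "\<dots> \<le> liminf (\<lambda>k. \<integral>\<^sup>+x. ennreal (u k x) \<partial>M)"
    using u by (intro nn_integral_liminf) auto
  also have "\<dots> = liminf (\<lambda>k. ennreal (\<integral>x. u k x \<partial>M))"
    using u by (subst nn_integral_eq_integral) auto
  also have "\<dots> \<le> limsup (\<lambda>k. ennreal (\<integral>x. u k x \<partial>M))"
    by (rule Liminf_le_Limsup) simp
  also have "\<dots> \<le> ennreal K"
    using K by (intro Limsup_bounded) (auto elim!: eventually_mono intro: ennreal_leI)
  finally show ?thesis using \<open>0 \<le> K\<close> by (simp add: ennreal_le_iff)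
qed

text \<open>By polarization the product is a combination of three integrable squares.\<close>

lemma integrable_mult_square:
  fixes f g :: "'a \<Rightarrow> real"
  assumes [measurable]: "f \<in> borel_measurable M" "g \<in> borel_measurable M"
    and "integrable M (\<lambda>\<omega>. (f \<omega>)\<^sup>2)" "integrable M (\<lambda>\<omega>. (g \<omega>)\<^sup>2)"
  shows "integrable M (\<lambda>\<omega>. f \<omega> * g \<omega>)"
proof -
  have "integrable M (\<lambda>\<omega>. ((f \<omega>)\<^sup>2 + (g \<omega>)\<^sup>2 - (f \<omega> - g \<omega>)\<^sup>2) / 2)"
    by (intro integrable_divide_zero Bochner_Integration.integrable_diff
        Bochner_Integration.integrable_add integrable_square_diff assms)
  also have "(\<lambda>\<omega>. ((f \<omega>)\<^sup>2 + (g \<omega>)\<^sup>2 - (f \<omega> - g \<omega>)\<^sup>2) / 2) = (\<lambda>\<omega>. f \<omega> * g \<omega>)"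
    by (simp add: power2_eq_square algebra_simps)
  finally show ?thesis .
qed

lemma integrable_exp_abs:
  fixes Z :: "'a \<Rightarrow> real"
  assumes "integrable M (\<lambda>\<omega>. exp (b * Z \<omega>))" "integrable M (\<lambda>\<omega>. exp (- b * Z \<omega>))"
    and [measurable]: "Z \<in> borel_measurable M"
  shows "integrable M (\<lambda>\<omega>. exp (b * \<bar>Z \<omega>\<bar>))"
proof (rule Bochner_Integration.integrable_bound)
  show "integrable M (\<lambda>\<omega>. exp (b * Z \<omega>) + exp (- b * Z \<omega>))"
    using assms by auto
  show "AE \<omega> in M. norm (exp (b * \<bar>Z \<omega>\<bar>)) \<le> norm (exp (b * Z \<omega>) + exp (- b * Z \<omega>))"
    by (intro AE_I2) (simp add: abs_of_pos add_pos_pos abs_if[of "Z _"])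
qed measurable

section \<open>Exponential moments of the channel output\<close>

locale gaussian_channel_mgf = gaussian_channel +
  fixes a :: real
  assumes a_pos: "0 < a"
    and mgf: "\<And>s. s \<in> {- a<..<a} \<Longrightarrow> integrable M (\<lambda>\<omega>. exp (s * X \<omega>))"
begin

lemma exp_abs_X: "0 \<le> b \<Longrightarrow> b < a \<Longrightarrow> integrable M (\<lambda>\<omega>. exp (b * \<bar>X \<omega>\<bar>))"
  using mgf[of b] mgf[of "- b"] by (intro integrable_exp_abs) auto

lemma exp_N: "integrable M (\<lambda>\<omega>. exp (b * N \<omega>))"
proof -
  \<comment> \<open>Completing the square: an exponential tilt of the standard Gaussian is a shifted
    Gaussian up to a constant.\<close>
  have "std_normal_density x * exp (b * x) = exp (b\<^sup>2 / 2) * normal_density b 1 x" for x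
    by (simp add: normal_density_def field_simps power2_eq_square flip: exp_add)
  then have "integrable lborel (\<lambda>x. std_normal_density x * exp (b * x))" by simp
  then show ?thesis
    by (subst (asm) distributed_integrable[OF N_distr]) auto
qed

lemma exp_abs_N: "integrable M (\<lambda>\<omega>. exp (b * \<bar>N \<omega>\<bar>))"
  using exp_N[of b] exp_N[of "- b"] by (intro integrable_exp_abs) auto

text \<open>By independence the expectation factors into exponential moments of X and N. A single
  \<open>c\<close> then dominates all outputs with \<bar>s\<bar> \<le> T at once.\<close>

lemma exp_channel:
  assumes "0 \<le> T"
  obtains c where "0 < c" "integrable M (\<lambda>\<omega>. exp (c * (T * \<bar>X \<omega>\<bar> + \<bar>N \<omega>\<bar>)))"
proof
  \<comment> \<open>This choice keeps \<open>c * T\<close> strictly below \<open>a\<close>, where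
    the moments of X are finite; \<open>T + 1\<close> in the denominator covers
    \<open>T = 0\<close>.\<close>
  define c where "c = a / (2 * (T + 1))"
  show "0 < c" using a_pos assms by (simp add: c_def)
  have "a * T < a * (2 * (T + 1))"
    using a_pos assms by (intro mult_strict_left_mono) auto
  then have cT: "0 \<le> c * T" "c * T < a"
    using a_pos assms by (auto simp: c_def divide_simps)
  have "indep_var borel ((\<lambda>x. exp (c * T * \<bar>x\<bar>)) \<circ> X) borel ((\<lambda>x. exp (c * \<bar>x\<bar>)) \<circ> N)"
    by (rule indep_var_compose[OF indep]) auto
  then have "integrable M (\<lambda>\<omega>. ((\<lambda>x. exp (c * T * \<bar>x\<bar>)) \<circ> X) \<omega> * ((\<lambda>x. exp (c * \<bar>x\<bar>)) \<circ> N) \<omega>)"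
    using exp_abs_X[OF cT] exp_abs_N[of c] by (intro indep_var_integrable) (auto simp: o_def)
  then show "integrable M (\<lambda>\<omega>. exp (c * (T * \<bar>X \<omega>\<bar> + \<bar>N \<omega>\<bar>)))"
    by (simp add: o_def distrib_left mult.assoc flip: exp_add)
qed

text \<open>The channel is parametrized by the amplitude \<open>s\<close>, which is
  \<open>sqrt t\<close> in the observation \<open>obs\<close>.\<close>

definition Y :: "real \<Rightarrow> 'a \<Rightarrow> real" where
  "Y s \<omega> = s * X \<omega> + N \<omega>"

lemma Y_measurable [measurable]: "Y s \<in> borel_measurable M"
  unfolding Y_def[abs_def] by measurable

lemma abs_Y_le: "\<bar>s\<bar> \<le> T \<Longrightarrow> \<bar>Y s \<omega>\<bar> \<le> T * \<bar>X \<omega>\<bar> + \<bar>N \<omega>\<bar>"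
  using mult_right_mono[of "\<bar>s\<bar>" T "\<bar>X \<omega>\<bar>"] abs_triangle_ineq[of "s * X \<omega>" "N \<omega>"]
  by (simp add: Y_def abs_mult)

lemma exp_moment_Y: "\<exists>c. exp_moment M (Y s) c"
proof -
  obtain c where c: "0 < c" and int: "integrable M (\<lambda>\<omega>. exp (c * (\<bar>s\<bar> * \<bar>X \<omega>\<bar> + \<bar>N \<omega>\<bar>)))"
    using exp_channel[of "\<bar>s\<bar>"] by auto
  have "integrable M (\<lambda>\<omega>. exp (c * \<bar>Y s \<omega>\<bar>))"
    by (rule Bochner_Integration.integrable_bound[OF int])
       (use c in \<open>auto intro!: abs_Y_le\<close>)
  then show ?thesis using c by (intro exI[of _ c]) (unfold_locales; simp)
qed

lemma X_sq: "integrable M (\<lambda>\<omega>. (X \<omega>)\<^sup>2)"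
  using integrable_poly_sq[OF X _ exp_abs_X[of "a/2"], of "[:0, 1:]"] a_pos by simp

lemma X_int: "integrable M X"
  by (rule square_integrable_imp_integrable[OF X X_sq])

lemma N_sq: "integrable M (\<lambda>\<omega>. (N \<omega>)\<^sup>2)"
  using integrable_poly_sq[OF N _ exp_abs_N[of 1], of "[:0, 1:]"] by simp

lemma poly_Y_sq: "integrable M (\<lambda>\<omega>. (poly p (Y s \<omega>))\<^sup>2)"
  using exp_moment_Y[of s] exp_moment.poly_sq by blast

section \<open>Errors of polynomial estimators and of the conditional mean\<close>

definition mse :: "real poly \<Rightarrow> real \<Rightarrow> real" where
  "mse p s = (\<integral>\<omega>. (X \<omega> - poly p (Y s \<omega>))\<^sup>2 \<partial>M)"

text \<open>A convergent sequence of amplitudes is bounded by some \<open>T\<close>, and the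
  exponential moment for that \<open>T\<close> supplies one dominating function for all of
  them.\<close>

lemma mse_tendsto:
  assumes s: "s \<longlonglongrightarrow> s0"
  shows "(\<lambda>k. mse p (s k)) \<longlonglongrightarrow> mse p s0"
proof -
  obtain T where T: "0 < T" "\<And>k. \<bar>s k\<bar> \<le> T"
    using Bseq_def[of s] convergent_imp_Bseq[OF convergentI[OF s]] by (auto simp: Bseq_def)
  obtain c where c: "0 < c" and int: "integrable M (\<lambda>\<omega>. exp (c * (T * \<bar>X \<omega>\<bar> + \<bar>N \<omega>\<bar>)))"
    using exp_channel[of T] T by auto
  obtain K where K: "0 \<le> K" "\<And>y. \<bar>poly (p * p) y\<bar> \<le> K * exp (c * \<bar>y\<bar>)"
    using abs_poly_le_exp[OF c, of "p * p"] by blast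
  show ?thesis
    unfolding mse_def
  proof (rule integral_dominated_convergence
      [where w = "\<lambda>\<omega>. 2 * (X \<omega>)\<^sup>2 + 2 * (K * exp (c * (T * \<bar>X \<omega>\<bar> + \<bar>N \<omega>\<bar>)))"])
    show "integrable M (\<lambda>\<omega>. 2 * (X \<omega>)\<^sup>2 + 2 * (K * exp (c * (T * \<bar>X \<omega>\<bar> + \<bar>N \<omega>\<bar>))))"
      using X_sq int by auto
    show "AE \<omega> in M. (\<lambda>k. (X \<omega> - poly p (Y (s k) \<omega>))\<^sup>2) \<longlonglongrightarrow> (X \<omega> - poly p (Y s0 \<omega>))\<^sup>2"
      unfolding Y_def by (intro AE_I2 tendsto_intros s)
    show "AE \<omega> in M. norm ((X \<omega> - poly p (Y (s k) \<omega>))\<^sup>2)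
        \<le> 2 * (X \<omega>)\<^sup>2 + 2 * (K * exp (c * (T * \<bar>X \<omega>\<bar> + \<bar>N \<omega>\<bar>)))" for k
    proof (intro AE_I2)
      fix \<omega>
      have "(poly p (Y (s k) \<omega>))\<^sup>2 \<le> K * exp (c * \<bar>Y (s k) \<omega>\<bar>)"
        using K(2)[of "Y (s k) \<omega>"] by (simp add: power2_eq_square)
      also have "\<dots> \<le> K * exp (c * (T * \<bar>X \<omega>\<bar> + \<bar>N \<omega>\<bar>))"
        using K(1) c by (auto intro!: mult_left_mono abs_Y_le T)
      finally have "(poly p (Y (s k) \<omega>))\<^sup>2 \<le> K * exp (c * (T * \<bar>X \<omega>\<bar> + \<bar>N \<omega>\<bar>))" .
      moreover have "(X \<omega> - poly p (Y (s k) \<omega>))\<^sup>2 \<le> 2 * (X \<omega>)\<^sup>2 + 2 * (poly p (Y (s k) \<omega>))\<^sup>2"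
        using zero_le_power2[of "X \<omega> + poly p (Y (s k) \<omega>)"] by (simp add: power2_eq_square algebra_simps)
      ultimately show "norm ((X \<omega> - poly p (Y (s k) \<omega>))\<^sup>2)
          \<le> 2 * (X \<omega>)\<^sup>2 + 2 * (K * exp (c * (T * \<bar>X \<omega>\<bar> + \<bar>N \<omega>\<bar>)))" by simp
    qed
  qed measurable
qed

definition post_mse :: "real \<Rightarrow> real" where
  "post_mse s = (\<integral>\<omega>. (X \<omega> - post s (Y s \<omega>))\<^sup>2 \<partial>M)"

lemma post_measurable [measurable]: "post s \<in> borel_measurable borel"
  by (rule borel_measurable_continuous_onI[OF continuous_post[OF X_int]])

definition F :: "real \<Rightarrow> 'a measure" where
  "F s = vimage_algebra (space M) (Y s) borel"

lemma subalgebra_F: "sigma_finite_subalgebra M (F s)"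
proof -
  interpret finite_measure_subalgebra M "F s"
    by standard (auto simp: F_def subalgebra_def sets_vimage_algebra2)
  show ?thesis by unfold_locales
qed

lemma Y_measurable_F: "Y s \<in> F s \<rightarrow>\<^sub>M borel"
  unfolding F_def by (rule measurable_vimage_algebra1) simp

lemma AE_cond_exp_F: "AE \<omega> in M. real_cond_exp M (F s) X \<omega> = post s (Y s \<omega>)"
  using AE_cond_exp_eq_post[OF X_int, of s] by (simp add: F_def Y_def[abs_def])

text \<open>Conditional Jensen for the square function, since \<open>post s\<close> of the output is
  a version of the conditional expectation.\<close>

lemma post_sq: "integrable M (\<lambda>\<omega>. (post s (Y s \<omega>))\<^sup>2)"
proof -
  interpret F: sigma_finite_subalgebra M "F s" by (rule subalgebra_F)
  have "integrable M (\<lambda>\<omega>. (real_cond_exp M (F s) X \<omega>)\<^sup>2)"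
    by (rule F.integrable_convex_cond_exp[where I = UNIV])
       (use X_int X_sq convex_power2 in \<open>auto simp: emeasure_space_1\<close>)
  then show ?thesis
    by (rule integrable_cong_AE_imp) (use AE_cond_exp_F[of s] in auto)
qed

lemma mmse_eq: "mmse M X N t = post_mse (sqrt t)"
proof -
  have "obs X N t = Y (sqrt t)" by (simp add: obs_def Y_def[abs_def])
  then show ?thesis
    unfolding mmse_def post_mse_def using AE_cond_exp_F[of "sqrt t"]
    by (intro integral_cong_AE) (auto simp: F_def)
qed

text \<open>Pythagoras: \<open>X - E[X | Y]\<close> is orthogonal to every square integrable function of \<open>Y\<close>.\<close>

lemma mse_decomp: "mse p s = post_mse s + (\<integral>\<omega>. (post s (Y s \<omega>) - poly p (Y s \<omega>))\<^sup>2 \<partial>M)"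
proof -
  interpret F: sigma_finite_subalgebra M "F s" by (rule subalgebra_F)
  define d where "d \<omega> = post s (Y s \<omega>) - poly p (Y s \<omega>)" for \<omega>
  define r where "r \<omega> = X \<omega> - post s (Y s \<omega>)" for \<omega>
  have dF: "d \<in> borel_measurable (F s)"
    unfolding d_def[abs_def] using Y_measurable_F[of s] by measurable
  have [measurable]: "d \<in> borel_measurable M" "r \<in> borel_measurable M"
    unfolding d_def[abs_def] r_def[abs_def] by measurable
  have d2: "integrable M (\<lambda>\<omega>. (d \<omega>)\<^sup>2)" and r2: "integrable M (\<lambda>\<omega>. (r \<omega>)\<^sup>2)"
    unfolding d_def r_def using X_sq post_sq[of s] poly_Y_sq[of p s]
    by (auto intro!: integrable_square_diff)
  have dX: "integrable M (\<lambda>\<omega>. d \<omega> * X \<omega>)" and dp: "integrable M (\<lambda>\<omega>. d \<omega> * post s (Y s \<omega>))"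
    and dr: "integrable M (\<lambda>\<omega>. d \<omega> * r \<omega>)"
    using d2 r2 X_sq post_sq[of s] by (auto intro!: integrable_mult_square)
  \<comment> \<open>\<open>d\<close> is a function of the output, so X may be replaced by its
    conditional expectation under the integral.\<close>
  have "(\<integral>\<omega>. d \<omega> * X \<omega> \<partial>M) = (\<integral>\<omega>. d \<omega> * real_cond_exp M (F s) X \<omega> \<partial>M)"
    by (rule F.real_cond_exp_intg(2)[OF dX dF X, symmetric])
  also have "\<dots> = (\<integral>\<omega>. d \<omega> * post s (Y s \<omega>) \<partial>M)"
    using AE_cond_exp_F[of s] by (intro integral_cong_AE) auto
  finally have orth: "(\<integral>\<omega>. d \<omega> * r \<omega> \<partial>M) = 0"
    using dX dp by (simp add: r_def right_diff_distrib)
  have "mse p s = (\<integral>\<omega>. (r \<omega>)\<^sup>2 + 2 * (d \<omega> * r \<omega>) + (d \<omega>)\<^sup>2 \<partial>M)"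
    unfolding mse_def by (rule Bochner_Integration.integral_cong)
      (auto simp: r_def d_def power2_eq_square algebra_simps)
  also have "\<dots> = (\<integral>\<omega>. (r \<omega>)\<^sup>2 \<partial>M) + (\<integral>\<omega>. (d \<omega>)\<^sup>2 \<partial>M)"
    using d2 r2 dr orth by simp
  finally show ?thesis by (simp add: post_mse_def r_def d_def)
qed

lemma post_mse_le: "post_mse s \<le> mse p s"
  unfolding mse_decomp[of p s] by simp

text \<open>By the Pythagorean identity the excess error is the squared L2 distance from the
  posterior mean to \<open>p\<close>, which density of polynomials makes arbitrarily small.\<close>

lemma ex_mse_less:
  assumes "e > 0"
  shows "\<exists>p. mse p s < post_mse s + e"
proof -
  obtain c where "exp_moment M (Y s) c" using exp_moment_Y by blast
  then interpret exp_moment M "Y s" c .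
  have "(\<lambda>\<omega>. post s (Y s \<omega>)) \<in> poly_closure M (Y s)"
    by (rule poly_closure_continuous[OF continuous_post[OF X_int] post_sq])
  from poly_closureD(3)[OF this assms] show ?thesis by (auto simp: mse_decomp)
qed

text \<open>Joint continuity of \<open>post\<close> makes the squared errors converge at every
  outcome, so Fatou's lemma applies on the fixed space \<open>M\<close>.\<close>

lemma post_mse_lower_semicontinuous:
  assumes s: "s \<longlonglongrightarrow> s0" and K: "\<forall>\<^sub>F k in sequentially. post_mse (s k) \<le> K"
  shows "post_mse s0 \<le> K"
  unfolding post_mse_def
proof (rule integral_le_of_tendsto)
  show "\<forall>\<^sub>F k in sequentially. (\<integral>\<omega>. (X \<omega> - post (s k) (Y (s k) \<omega>))\<^sup>2 \<partial>M) \<le> K"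
    using K by (simp add: post_mse_def)
  show "(\<lambda>k. (X \<omega> - post (s k) (Y (s k) \<omega>))\<^sup>2) \<longlonglongrightarrow> (X \<omega> - post s0 (Y s0 \<omega>))\<^sup>2" for \<omega>
    unfolding Y_def by (intro tendsto_intros post_tendsto[OF X_int] s)
qed (use X_sq post_sq in \<open>auto intro!: integrable_square_diff\<close>)

section \<open>From pointwise to uniform convergence\<close>

lemma pmmse_eq: "pmmse M X N n t =
    (INF c. mse (\<Sum>i\<le>n. monom (c i) i) (sqrt t))"
  by (simp add: pmmse_def mse_def obs_def Y_def poly_sum poly_monom)

lemma post_mse_le_pmmse: "post_mse (sqrt t) \<le> pmmse M X N n t"
  unfolding pmmse_eq by (intro cINF_greatest post_mse_le) auto

lemma pmmse_le_mse:
  assumes "degree p \<le> n"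
  shows "pmmse M X N n t \<le> mse p (sqrt t)"
proof -
  have "pmmse M X N n t \<le> mse (\<Sum>i\<le>n. monom (coeff p i) i) (sqrt t)"
    unfolding pmmse_eq
    \<comment> \<open>A real infimum is a lower bound only for a set bounded below; the error of the
      conditional mean provides that bound.\<close>
    by (intro cINF_lower bdd_belowI[of _ "post_mse (sqrt t)"]) (auto intro: post_mse_le)
  also have "(\<Sum>i\<le>n. monom (coeff p i) i) = p"
    by (rule poly_as_sum_of_monoms'[OF assms])
  finally show ?thesis .
qed

text \<open>Dividing the output by \<open>sqrt t\<close> recovers X up to the error
  \<open>N / sqrt t\<close>, and this estimator has degree 1.\<close>

lemma pmmse_le_inverse:
  assumes "1 \<le> n" "0 < t"
  shows "pmmse M X N n t \<le> (\<integral>\<omega>. (N \<omega>)\<^sup>2 \<partial>M) / t"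
proof -
  have "pmmse M X N n t \<le> mse [:0, 1 / sqrt t:] (sqrt t)"
    using assms by (intro pmmse_le_mse) auto
  also have "\<dots> = (\<integral>\<omega>. (N \<omega>)\<^sup>2 / t \<partial>M)"
    unfolding mse_def
  proof (rule Bochner_Integration.integral_cong[OF refl])
    fix \<omega>
    have "X \<omega> - poly [:0, 1 / sqrt t:] (Y (sqrt t) \<omega>) = - (N \<omega> / sqrt t)"
      using assms by (simp add: Y_def field_simps)
    then show "(X \<omega> - poly [:0, 1 / sqrt t:] (Y (sqrt t) \<omega>))\<^sup>2 = (N \<omega>)\<^sup>2 / t"
      using assms by (simp only: power2_minus) (simp add: power_divide)
  qed
  also have "\<dots> = (\<integral>\<omega>. (N \<omega>)\<^sup>2 \<partial>M) / t" by simp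
  finally show ?thesis .
qed

text \<open>Dini's argument by contradiction: gaps above \<open>e\<close> at growing degrees occur
  at parameters in a compact interval, and an accumulation point contradicts lower semicontinuity of
  \<open>post_mse\<close>.\<close>

lemma gap_uniformly_small:
  assumes "e > 0"
  shows "\<exists>n0. \<forall>n\<ge>n0. \<forall>t\<ge>0. pmmse M X N n t - post_mse (sqrt t) \<le> e"
proof (rule ccontr)
  assume "\<not> ?thesis"
  \<comment> \<open>\<open>Suc k\<close> rather than \<open>k\<close> makes every degree at least 1,
    so that the linear estimator is available.\<close>
  then have "\<forall>k. \<exists>n t. n \<ge> Suc k \<and> t \<ge> 0 \<and> pmmse M X N n t - post_mse (sqrt t) > e"
    by (meson not_le)
  then obtain n t where n: "\<And>k. n k \<ge> Suc k" and t: "\<And>k. t k \<ge> 0"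
    and gap: "\<And>k. pmmse M X N (n k) (t k) - post_mse (sqrt (t k)) > e"
    by metis
  define V where "V = (\<integral>\<omega>. (N \<omega>)\<^sup>2 \<partial>M)"
  have "V \<ge> 0" unfolding V_def by (rule integral_nonneg_AE) auto
  have post_nonneg: "0 \<le> post_mse s" for s unfolding post_mse_def by (rule integral_nonneg_AE) auto
  \<comment> \<open>For positive \<open>t k\<close> the bound \<open>V / t k\<close> on the gap must
    exceed \<open>e\<close>, which keeps the parameters bounded.\<close>
  have "t k \<in> {0..V / e}" for k
  proof (cases "t k = 0")
    case False
    then have "t k > 0" using t[of k] by simp
    then have "e < V / t k"
      using pmmse_le_inverse[of "n k" "t k"] n[of k] gap[of k] post_nonneg[of "sqrt (t k)"]
      by (simp add: V_def)
    then show ?thesis using \<open>t k > 0\<close> assms by (simp add: field_simps)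
  qed (use \<open>V \<ge> 0\<close> assms in auto)
  then obtain l r where r: "strict_mono r" and l: "(t \<circ> r) \<longlonglongrightarrow> l"
    using compact_imp_seq_compact[OF compact_Icc, of 0 "V / e"] unfolding seq_compact_def by metis
  define s where "s k = sqrt (t (r k))" for k
  have s: "s \<longlonglongrightarrow> sqrt l"
    using l unfolding s_def[abs_def] o_def by (rule tendsto_real_sqrt)
  \<comment> \<open>One polynomial, nearly optimal at the limit point, serves for all nearby
    parameters.\<close>
  obtain p where p: "mse p (sqrt l) < post_mse (sqrt l) + e/2"
    using ex_mse_less[of "e/2"] assms by auto
  have "\<forall>\<^sub>F k in sequentially. mse p (s k) < post_mse (sqrt l) + e/2"
    by (rule order_tendstoD(2)[OF mse_tendsto[OF s] p])
  moreover have "\<forall>\<^sub>F k in sequentially. degree p \<le> k" by (rule eventually_ge_at_top)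
  \<comment> \<open>Once the allowed degree reaches that of \<open>p\<close>, the gap puts
    \<open>post_mse (s k)\<close> more than \<open>e\<close> below \<open>mse p (s k)\<close>, which
    is less than \<open>post_mse (sqrt l) + e/2\<close>.\<close>
  ultimately have "\<forall>\<^sub>F k in sequentially. post_mse (s k) \<le> post_mse (sqrt l) - e/2"
  proof eventually_elim
    case (elim k)
    have "degree p \<le> n (r k)"
      using elim(2) n[of "r k"] seq_suble[OF r, of k] by linarith
    from pmmse_le_mse[OF this, of "t (r k)"] gap[of "r k"] elim(1) show ?case
      by (simp add: s_def)
  qed
  \<comment> \<open>In the limit \<open>post_mse (sqrt l)\<close> would lie below itself by
    \<open>e/2\<close>.\<close>
  from post_mse_lower_semicontinuous[OF s this] assms show False by simp
qed

lemma SUP_gap_tendsto: "(\<lambda>n. SUP t\<in>{0..}. pmmse M X N n t - mmse M X N t) \<longlonglongrightarrow> 0"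
proof (rule LIMSEQ_I)
  fix e :: real assume "e > 0"
  let ?g = "\<lambda>n t. pmmse M X N n t - mmse M X N t"
  obtain n0 where n0: "\<And>n t. n \<ge> n0 \<Longrightarrow> t \<ge> 0 \<Longrightarrow> ?g n t \<le> e/2"
    using gap_uniformly_small[of "e/2"] \<open>e > 0\<close> by (auto simp: mmse_eq)
  have g_nonneg: "0 \<le> ?g n t" for n t
    using post_mse_le_pmmse[of t n] by (simp add: mmse_eq)
  have "norm ((SUP t\<in>{0..}. ?g n t) - 0) < e" if "n \<ge> n0" for n
  proof -
    \<comment> \<open>The real supremum is meaningful only for a bounded set. The point
      \<open>t = 0\<close> then shows that it is nonnegative, and the margin \<open>e/2\<close>
      gives the strict inequality.\<close>
    have "bdd_above (?g n ` {0..})"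
      using n0[OF that] by (intro bdd_aboveI[of _ "e/2"]) auto
    then have "?g n 0 \<le> (SUP t\<in>{0..}. ?g n t)" by (intro cSUP_upper) auto
    moreover have "(SUP t\<in>{0..}. ?g n t) \<le> e/2"
      using n0[OF that] by (intro cSUP_least) auto
    ultimately show ?thesis using g_nonneg[of n 0] \<open>e > 0\<close> by (simp add: abs_le_iff)
  qed
  then show "\<exists>n0. \<forall>n\<ge>n0. norm ((SUP t\<in>{0..}. ?g n t) - 0) < e" by blast
qed

end

theorem theorem5p4:
  fixes M :: "'a measure" and X N :: "'a \<Rightarrow> real"
  assumes "prob_space M"
    and "X \<in> borel_measurable M"
    and "distributed M lborel N std_normal_density"
    and "prob_space.indep_var M borel X borel N"
    and "\<exists>a>0. \<forall>s\<in>{-a<..<a}. integrable M (\<lambda>\<omega>. exp (s * X \<omega>))"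
  shows "(\<lambda>n. SUP t\<in>{0..}. pmmse M X N n t - mmse M X N t) \<longlonglongrightarrow> 0"
proof -
  obtain a where "a > 0" "\<And>s. s \<in> {-a<..<a} \<Longrightarrow> integrable M (\<lambda>\<omega>. exp (s * X \<omega>))"
    using assms(5) by blast
  with assms(1-4) interpret gaussian_channel_mgf M X N a
    by (simp add: gaussian_channel_mgf_def gaussian_channel_mgf_axioms_def
        gaussian_channel_def gaussian_channel_axioms_def)
  show ?thesis by (rule SUP_gap_tendsto)
qed

end
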